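(* Let $\Gamma_0$ be a finite group acting linearly on a real vector space $V$. Then every arrow in the diagram of the isotropy lattice of the $\Gamma_0$ action on $V$ is an arrow in the bifurcation digraph of the $\Gamma_0$ action on $V$. That is, for any two symmetry types $S, S'$ of the $\Gamma_0$ action on $V$, if there is an arrow from $S$ to $S'$ in the diagram of the isotropy lattice, then there is an arrow from $S$ to $S'$ in the bifurcation digraph.
   Context: Throughout, groups are finite and act linearly on real vector spaces (via a homomorphism to $GL(V)$). Stabilizers and isotropy subgroups. For a group $\Gamma$ acting on $V$ and $v\in V$, $\mathrm{Stab}(v,\Gamma)=\{\gamma\in\Gamma \mid \gamma\cdot v=v\}$. An isotropy subgroup of the $\Gamma$ action on $V$ is a subgroup of the form $\mathrm{Stab}(v,\Gamma)$ for some $v\in V$. For a subgroup $\Sigma\le\Gamma$, $\mathrm{Fix}(\Sigma,V)=\{v\in V\mid \gamma\cdot v=v \text{ for all }\gamma\in\Sigma\}$. A maximal isotropy subgroup of a $\Gamma$ action on $V$ is an isotropy subgroup $\Sigma\neq\Gamma$ of that action such that, whenever $\Theta$ is an isotropy subgroup of that action with $\Sigma\le\Theta$, either $\Theta=\Sigma$ or $\Theta=\Gamma$. Symmetry types and isotropy lattice. The symmetry type of $v\in V$ for the $\Gamma_0$ action is the conjugacy class (in $\Gamma_0$) of $\mathrm{Stab}(v,\Gamma_0)$; thus the symmetry types are the conjugacy classes $[\Sigma]$ of isotropy subgroups $\Sigma$ of the $\Gamma_0$ action on $V$. The set $\mathcal{S}$ of symmetry types is partially ordered by: $S_i\le S_j$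 if there exist $\Sigma_i\in S_i$ and $\Sigma_j\in S_j$ with $\Sigma_i\le\Sigma_j$. The poset $(\mathcal{S},\le)$ is called the lattice of isotropy subgroups (isotropy lattice). Its diagram is the directed graph with vertex set $\mathcal{S}$ and an arrow from $S_j$ to $S_i$ if and only if $S_i\lneq S_j$ and there is no symmetry type strictly between $S_i$ and $S_j$. Isotypic components. For a group $\Gamma$ acting on $V$, an irreducible subspace of $V$ is a $\Gamma$-invariant subspace with no proper (nonzero) $\Gamma$-invariant subspaces. Let $\alpha^{(j)}$ run over the irreducible representations of $\Gamma$ over $\mathbb{R}$ (up to similarity). The isotypic component $V_\Gamma^{(j)}$ of $V$ is the sum of all irreducible subspaces of $V$ corresponding to $\alpha^{(j)}$; the isotypic decomposition is $V=\bigoplus_j V_\Gamma^{(j)}$. Bifurcation digraph. The bifurcation digraph of the $\Gamma_0$ action on a real vector space $V$ is a directed graph with labelled arrows. The vertices are the symmetry types. Given two isotropy subgroups $\Sigma\le\Gamma$ of the $\Gamma_0$ action on $V$, there is an arrow from $[\Gamma]$ to $[\Sigma]$ if and only if $\Sigma$ is a maximal isotropy subgroup of the $\Gamma$ action on some isotypic component $V_\Gamma^{(j)}$ of $V$. Each arrow has the label $\Gamma/\Gamma'$, where $\Gamma'$ is the kernel of the $\Gamma$ action on $V_\Gamma^{(j)}$. Moreover, with $E$ any irreducible subspace contained in $V_\Gamma^{(j)}$ and $N_\Gamma(\Sigma)$ the normalizer of $\Sigma$ in $\Gamma$, the arrow is drawn solid if $\dim\mathrm{Fix}(\Sigma,E)=1$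 and $N_\Gamma(\Sigma)/\Sigma\cong\mathbb{Z}_2$, dashed if $\dim\mathrm{Fix}(\Sigma,E)=1$ and $N_\Gamma(\Sigma)/\Sigma$ is trivial, and dotted if $\dim\mathrm{Fix}(\Sigma,E)\ge2$. The claim concerns only the existence of arrows, not their labels or types. *)

theory Defs
  imports
    "HOL-Algebra.Group_Action"
    "Jordan_Normal_Form.VS_Connect"
begin

text \<open>
  The real vector space is the whole of a type of class \<open>real_vector\<close> (of any dimension).
  A subgroup \<open>H\<close> of \<open>G\<close> acts by restriction; it is passed to the definitions below as the
  group \<open>G\<lparr>carrier := H\<rparr>\<close>.
\<close>

locale linear_group_action = group_action G "UNIV :: 'v::real_vector set" \<phi>
  for G (structure) and \<phi> :: "'g \<Rightarrow> 'v::real_vector \<Rightarrow> 'v" +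
  assumes linear_action: "g \<in> carrier G \<Longrightarrow> linear (\<phi> g)"


section \<open>Isotropy subgroups and symmetry types\<close>

definition isotropy_subgroups ::
    "('g, 'm) monoid_scheme \<Rightarrow> ('g \<Rightarrow> 'v \<Rightarrow> 'v) \<Rightarrow> 'v set \<Rightarrow> 'g set set" where
  "isotropy_subgroups G \<phi> W = {stabilizer G \<phi> w | w. w \<in> W}"

definition maximal_isotropy_subgroup ::
    "('g, 'm) monoid_scheme \<Rightarrow> ('g \<Rightarrow> 'v \<Rightarrow> 'v) \<Rightarrow> 'v set \<Rightarrow> 'g set \<Rightarrow> bool" where
  "maximal_isotropy_subgroup G \<phi> W \<Sigma> \<longleftrightarrow>
     \<Sigma> \<in> isotropy_subgroups G \<phi> W \<and> \<Sigma> \<noteq> carrier G \<and>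
     (\<forall>\<Theta> \<in> isotropy_subgroups G \<phi> W. \<Sigma> \<subseteq> \<Theta> \<longrightarrow> \<Theta> = \<Sigma> \<or> \<Theta> = carrier G)"

definition conjugacy_class :: "('g, 'm) monoid_scheme \<Rightarrow> 'g set \<Rightarrow> 'g set set" where
  "conjugacy_class G \<Sigma> = orbit G (\<lambda>g K. g <#\<^bsub>G\<^esub> K #>\<^bsub>G\<^esub> (inv\<^bsub>G\<^esub> g)) \<Sigma>"

definition symmetry_types ::
    "('g, 'm) monoid_scheme \<Rightarrow> ('g \<Rightarrow> 'v \<Rightarrow> 'v) \<Rightarrow> 'g set set set" where
  "symmetry_types G \<phi> = {conjugacy_class G \<Sigma> | \<Sigma>. \<Sigma> \<in> isotropy_subgroups G \<phi> UNIV}"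

definition symmetry_type_le :: "'g set set \<Rightarrow> 'g set set \<Rightarrow> bool" where
  "symmetry_type_le S T \<longleftrightarrow> (\<exists>\<Sigma> \<in> S. \<exists>\<Theta> \<in> T. \<Sigma> \<subseteq> \<Theta>)"

definition symmetry_type_less :: "'g set set \<Rightarrow> 'g set set \<Rightarrow> bool" where
  "symmetry_type_less S T \<longleftrightarrow> symmetry_type_le S T \<and> S \<noteq> T"

text \<open>Arrows point downwards, from the larger symmetry type to the smaller one.\<close>

definition isotropy_lattice_arrow ::
    "('g, 'm) monoid_scheme \<Rightarrow> ('g \<Rightarrow> 'v \<Rightarrow> 'v) \<Rightarrow> 'g set set \<Rightarrow> 'g set set \<Rightarrow> bool" where
  "isotropy_lattice_arrow G \<phi> S S' \<longleftrightarrow>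
     S \<in> symmetry_types G \<phi> \<and> S' \<in> symmetry_types G \<phi> \<and> symmetry_type_less S' S \<and>
     \<not> (\<exists>T \<in> symmetry_types G \<phi>. symmetry_type_less S' T \<and> symmetry_type_less T S)"


section \<open>Isotypic components\<close>

definition invariant_subspace ::
    "('g, 'm) monoid_scheme \<Rightarrow> ('g \<Rightarrow> 'v::real_vector \<Rightarrow> 'v) \<Rightarrow> 'v set \<Rightarrow> bool" where
  "invariant_subspace G \<phi> W \<longleftrightarrow>
     Real_Vector_Spaces.subspace W \<and> (\<forall>g \<in> carrier G. \<forall>w \<in> W. \<phi> g w \<in> W)"

definition irreducible_subspace ::
    "('g, 'm) monoid_scheme \<Rightarrow> ('g \<Rightarrow> 'v::real_vector \<Rightarrow> 'v) \<Rightarrow> 'v set \<Rightarrow> bool" where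
  "irreducible_subspace G \<phi> E \<longleftrightarrow>
     invariant_subspace G \<phi> E \<and> E \<noteq> {0} \<and>
     (\<forall>U. invariant_subspace G \<phi> U \<and> U \<subseteq> E \<longrightarrow> U = {0} \<or> U = E)"

text \<open>
  Irreducible representations over the reals are matrix representations, that is,
  homomorphisms into the general linear group of degree \<open>n\<close> (the group of units of the matrix
  ring). All of them are finite-dimensional since the group is finite.
\<close>

definition irreducible_representation ::
    "('g, 'm) monoid_scheme \<Rightarrow> nat \<Rightarrow> ('g \<Rightarrow> real mat) \<Rightarrow> bool" where
  "irreducible_representation G n \<alpha> \<longleftrightarrow>
     \<alpha> \<in> hom G (units_of (ring_mat TYPE(real) n ())) \<and> n > 0 \<and>
     (\<forall>W. VectorSpace.subspace class_ring W (module_vec TYPE(real) n) \<and>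
          (\<forall>g \<in> carrier G. \<forall>w \<in> W. \<alpha> g *\<^sub>v w \<in> W)
        \<longrightarrow> W = {0\<^sub>v n} \<or> W = carrier_vec n)"

text \<open>
  \<open>E\<close> corresponds to \<open>\<alpha>\<close> if, with respect to some ordered basis of \<open>E\<close>, each group
  element \<open>g\<close> acts on \<open>E\<close> by the matrix \<open>\<alpha> g\<close>. Similar representations have
  the same corresponding subspaces.
\<close>

definition corresponds_to ::
    "('g, 'm) monoid_scheme \<Rightarrow> ('g \<Rightarrow> 'v::real_vector \<Rightarrow> 'v) \<Rightarrow> 'v set \<Rightarrow> nat \<Rightarrow>
     ('g \<Rightarrow> real mat) \<Rightarrow> bool" where
  "corresponds_to G \<phi> E n \<alpha> \<longleftrightarrow>
     (\<exists>b. length b = n \<and> distinct b \<and> independent (set b) \<and> span (set b) = E \<and>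
          (\<forall>g \<in> carrier G. \<forall>j < n. \<phi> g (b ! j) = (\<Sum>i<n. (\<alpha> g $$ (i, j)) *\<^sub>R (b ! i))))"

definition isotypic_component ::
    "('g, 'm) monoid_scheme \<Rightarrow> ('g \<Rightarrow> 'v::real_vector \<Rightarrow> 'v) \<Rightarrow> nat \<Rightarrow> ('g \<Rightarrow> real mat) \<Rightarrow>
     'v set" where
  "isotypic_component G \<phi> n \<alpha> =
     span (\<Union>{E. irreducible_subspace G \<phi> E \<and> corresponds_to G \<phi> E n \<alpha>})"

definition isotypic_components ::
    "('g, 'm) monoid_scheme \<Rightarrow> ('g \<Rightarrow> 'v::real_vector \<Rightarrow> 'v) \<Rightarrow> 'v set set" where
  "isotypic_components G \<phi> =
     {isotypic_component G \<phi> n \<alpha> | n \<alpha>. irreducible_representation G n \<alpha>}"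


section \<open>The bifurcation digraph\<close>

text \<open>Only the arrow relation is recorded, not the labels and line styles of the arrows.\<close>

definition bifurcation_arrow ::
    "('g, 'm) monoid_scheme \<Rightarrow> ('g \<Rightarrow> 'v::real_vector \<Rightarrow> 'v) \<Rightarrow> 'g set set \<Rightarrow> 'g set set \<Rightarrow>
     bool" where
  "bifurcation_arrow G \<phi> S S' \<longleftrightarrow>
     (\<exists>\<Gamma> \<in> isotropy_subgroups G \<phi> UNIV. \<exists>\<Sigma> \<in> isotropy_subgroups G \<phi> UNIV.
        \<Sigma> \<subseteq> \<Gamma> \<and> S = conjugacy_class G \<Gamma> \<and> S' = conjugacy_class G \<Sigma> \<and>
        (\<exists>W \<in> isotypic_components (G\<lparr>carrier := \<Gamma>\<rparr>) \<phi>.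
           maximal_isotropy_subgroup (G\<lparr>carrier := \<Gamma>\<rparr>) \<phi> W \<Sigma>))"

end

theory Submission
  imports Defs
begin

text \<open>
  An arrow of the isotropy lattice is represented by isotropy subgroups \<open>\<Sigma> \<subset> \<Gamma>\<close> of \<open>G\<close>
  whose classes have no symmetry type strictly between them. The point is to find an isotypic
  component \<open>W\<close> of the \<open>\<Gamma>\<close> action and a vector \<open>w \<in> W\<close> with
  \<open>\<Sigma> \<subseteq> Stab(w, \<Gamma>) \<noteq> \<Gamma>\<close>. Everything else follows from the covering relation. Indeed, any
  \<open>Stab(x, \<Gamma>)\<close> is the intersection of two isotropy subgroups of \<open>G\<close>, hence is itself an
  isotropy subgroup of \<open>G\<close> (\<open>Int_of_stabilizers_is_stabilizer\<close>). If it contains \<open>\<Sigma>\<close>, its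
  symmetry type lies between those of \<open>\<Sigma>\<close> and \<open>\<Gamma>\<close>, so it is conjugate to one of them, and by
  finiteness equal to it (\<open>no_isotropy_subgroup_inside_lattice_arrow\<close>). This yields both
  \<open>Stab(w, \<Gamma>) = \<Sigma>\<close> and the maximality of \<open>\<Sigma>\<close> among the isotropy subgroups on \<open>W\<close>.

  To find \<open>w\<close>, write \<open>\<Sigma> = Stab(v, G)\<close>, so that \<open>v\<close> is fixed by \<open>\<Sigma>\<close> but not by \<open>\<Gamma>\<close>. Among
  all finite-dimensional \<open>\<Gamma>\<close>-invariant subspaces containing some vector that is fixed by \<open>\<Sigma>\<close>
  but not by \<open>\<Gamma>\<close> (the span of the \<open>\<Gamma>\<close>-orbit of \<open>v\<close> is one) take one of least dimension. If it
  had a proper nonzero invariant subspace, Maschke's projection would split the vector into two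
  \<open>\<Sigma>\<close>-fixed parts in smaller invariant subspaces, both fixed by \<open>\<Gamma>\<close> by minimality; then so
  would be their sum. Hence the minimal subspace is irreducible
  (\<open>irreducible_subspace_with_new_fixed_vector\<close>). Choosing a basis turns it into an irreducible
  matrix representation (\<open>irreducible_subspace_has_representation\<close>), so it is contained in an
  isotypic component.
\<close>

section \<open>Stabilizers and their conjugates\<close>

context linear_group_action
begin

lemma group_G: "group G"
  using group_hom by (simp add: group_hom_def)

lemma act_mult:
  "\<lbrakk>g \<in> carrier G; h \<in> carrier G\<rbrakk> \<Longrightarrow> \<phi> (g \<otimes> h) v = \<phi> g (\<phi> h v)"
  using composition_rule by blast

lemma act_one: "\<phi> \<one> v = v"
  using id_eq_one by (metis UNIV_I restrict_apply')

lemma act_inv_left: "g \<in> carrier G \<Longrightarrow> \<phi> (inv g) (\<phi> g v) = v"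
  using group_G by (simp add: act_mult[symmetric] act_one group.l_inv)

lemma act_inv_right: "g \<in> carrier G \<Longrightarrow> \<phi> g (\<phi> (inv g) v) = v"
  using group_G by (simp add: act_mult[symmetric] act_one group.r_inv)

lemma restrict_to_subgroup:
  assumes "subgroup H G"
  shows "linear_group_action (G\<lparr>carrier := H\<rparr>) \<phi>"
proof -
  have sub: "H \<subseteq> carrier G"
    using assms by (rule subgroup.subset)
  have "\<phi> \<in> hom (G\<lparr>carrier := H\<rparr>) (BijGroup UNIV)"
    using group_hom sub by (fastforce simp: group_hom_def group_hom_axioms_def hom_def)
  then have "group_hom (G\<lparr>carrier := H\<rparr>) (BijGroup UNIV) \<phi>"
    using group.subgroup_imp_group[OF group_G assms] group_BijGroup
    by (simp add: group_hom_def group_hom_axioms_def)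
  then show ?thesis
    using sub linear_action
    by (auto simp: linear_group_action_def group_action_def linear_group_action_axioms_def)
qed

lemma stabilizer_of_translate:
  assumes g: "g \<in> carrier G"
  shows "stabilizer G \<phi> (\<phi> g v) = g <# stabilizer G \<phi> v #> inv g"
proof -
  interpret group G by (rule group_G)
  have "stabilizer G \<phi> (\<phi> g v) = (\<lambda>h. g \<otimes> h \<otimes> inv g) ` stabilizer G \<phi> v"
  proof (intro equalityI subsetI)
    fix k assume k: "k \<in> stabilizer G \<phi> (\<phi> g v)"
    then have kG: "k \<in> carrier G"
      by (simp add: stabilizer_def)
    have "inv g \<otimes> k \<otimes> g \<in> stabilizer G \<phi> v"
      using k kG g by (simp add: stabilizer_def act_mult act_inv_left)
    moreover have "k = g \<otimes> (inv g \<otimes> k \<otimes> g) \<otimes> inv g"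
      using kG g by (metis inv_closed inv_solve_left m_assoc m_closed r_inv r_one)
    ultimately show "k \<in> (\<lambda>h. g \<otimes> h \<otimes> inv g) ` stabilizer G \<phi> v"
      by blast
  next
    fix k assume "k \<in> (\<lambda>h. g \<otimes> h \<otimes> inv g) ` stabilizer G \<phi> v"
    then show "k \<in> stabilizer G \<phi> (\<phi> g v)"
      using g by (auto simp: stabilizer_def act_mult act_inv_left)
  qed
  then show ?thesis
    by (auto simp: l_coset_def r_coset_def)
qed

lemma card_stabilizer_of_translate:
  assumes g: "g \<in> carrier G"
  shows "card (stabilizer G \<phi> (\<phi> g v)) = card (stabilizer G \<phi> v)"
proof -
  interpret group G by (rule group_G)
  have sub: "stabilizer G \<phi> v \<subseteq> carrier G"
    by (rule stabilizer_subset)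
  have "g <# stabilizer G \<phi> v #> inv g = (\<lambda>h. g \<otimes> h \<otimes> inv g) ` stabilizer G \<phi> v"
    by (auto simp: l_coset_def r_coset_def)
  moreover have "inj_on (\<lambda>h. g \<otimes> h \<otimes> inv g) (stabilizer G \<phi> v)"
    using sub g by (intro inj_onI) (simp add: subset_iff)
  ultimately show ?thesis
    by (simp add: stabilizer_of_translate[OF g] card_image)
qed

lemma conjugacy_class_stabilizer:
  "conjugacy_class G (stabilizer G \<phi> v) = {stabilizer G \<phi> (\<phi> g v) | g. g \<in> carrier G}"
  unfolding conjugacy_class_def orbit_def using stabilizer_of_translate by blast

text \<open>
  A symmetry type is an orbit under conjugation, so it is the class of any of its members; and a
  conjugate of a stabilizer is the stabilizer of a translated vector.
\<close>

lemma representative_of_symmetry_type: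
  assumes "S \<in> symmetry_types G \<phi>" and "\<Theta> \<in> S"
  shows "\<Theta> \<in> isotropy_subgroups G \<phi> UNIV" and "S = conjugacy_class G \<Theta>"
proof -
  interpret group G by (rule group_G)
  obtain v where v: "S = conjugacy_class G (stabilizer G \<phi> v)"
    using assms(1) unfolding symmetry_types_def isotropy_subgroups_def by blast
  obtain g where g: "g \<in> carrier G" "\<Theta> = stabilizer G \<phi> (\<phi> g v)"
    using assms(2) unfolding v conjugacy_class_stabilizer by blast
  have "\<exists>k\<in>carrier G. \<phi> h v = \<phi> k (\<phi> g v)" if "h \<in> carrier G" for h
    using that g(1) by (intro bexI[of _ "h \<otimes> inv g"]) (simp_all add: act_mult act_inv_left)
  moreover have "\<exists>k\<in>carrier G. \<phi> h (\<phi> g v) = \<phi> k v" if "h \<in> carrier G" for h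
    using that g(1) by (intro bexI[of _ "h \<otimes> g"]) (simp_all add: act_mult)
  ultimately show "S = conjugacy_class G \<Theta>"
    unfolding v g(2) conjugacy_class_stabilizer by (auto; metis)
  show "\<Theta> \<in> isotropy_subgroups G \<phi> UNIV"
    unfolding g(2) isotropy_subgroups_def by blast
qed

lemma stabilizer_in_own_class:
  "stabilizer G \<phi> v \<in> conjugacy_class G (stabilizer G \<phi> v)"
proof -
  interpret group G by (rule group_G)
  show ?thesis
    unfolding conjugacy_class_stabilizer by (auto intro!: exI[of _ "\<one>"] simp: act_one)
qed

text \<open>
  Conjugate subgroups have the same number of elements. This makes the order on symmetry types
  antisymmetric on nested representatives.
\<close>

lemma nested_conjugate_stabilizers_eq:
  assumes fin: "finite (carrier G)"
    and "stabilizer G \<phi> v \<subseteq> stabilizer G \<phi> w"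
    and "conjugacy_class G (stabilizer G \<phi> v) = conjugacy_class G (stabilizer G \<phi> w)"
  shows "stabilizer G \<phi> v = stabilizer G \<phi> w"
proof -
  have "stabilizer G \<phi> v \<in> conjugacy_class G (stabilizer G \<phi> w)"
    using stabilizer_in_own_class[of v] assms(3) by simp
  then obtain g where "g \<in> carrier G" "stabilizer G \<phi> v = stabilizer G \<phi> (\<phi> g w)"
    by (auto simp: conjugacy_class_stabilizer)
  then have "card (stabilizer G \<phi> v) = card (stabilizer G \<phi> w)"
    by (simp add: card_stabilizer_of_translate)
  then show ?thesis
    using assms(2) finite_subset[OF stabilizer_subset fin] by (intro card_subset_eq) auto
qed

text \<open>
  The vector \<open>x = u + e w\<close> works for a generic scalar \<open>e\<close>: a group element that moves \<open>u\<close> or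
  \<open>w\<close> can fix \<open>u + e w\<close> for at most one \<open>e\<close>, and finitely many elements exclude only finitely
  many scalars.
\<close>

lemma Int_of_stabilizers_is_stabilizer:
  assumes fin: "finite (carrier G)"
  obtains x where "stabilizer G \<phi> x = stabilizer G \<phi> u \<inter> stabilizer G \<phi> w"
proof -
  \<comment> \<open>The scalars for which \<open>g\<close> fixes the combination without fixing both vectors.\<close>
  define bad where "bad g = {e. (\<phi> g u \<noteq> u \<or> \<phi> g w \<noteq> w) \<and> \<phi> g (u + e *\<^sub>R w) = u + e *\<^sub>R w}" for g
  have lin: "\<phi> g (u + e *\<^sub>R w) = \<phi> g u + e *\<^sub>R \<phi> g w" if "g \<in> carrier G" for g e
    using linear_action[OF that] by (simp add: linear_add linear_scale)
  have "finite (bad g)" if g: "g \<in> carrier G" for g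
  proof -
    have "d = e" if "d \<in> bad g" "e \<in> bad g" for d e
    proof (rule ccontr)
      assume "d \<noteq> e"
      have *: "\<phi> g u + d *\<^sub>R \<phi> g w = u + d *\<^sub>R w" "\<phi> g u + e *\<^sub>R \<phi> g w = u + e *\<^sub>R w"
        using that lin[OF g] by (auto simp: bad_def)
      have "(\<phi> g u + d *\<^sub>R \<phi> g w) - (\<phi> g u + e *\<^sub>R \<phi> g w) = (u + d *\<^sub>R w) - (u + e *\<^sub>R w)"
        by (simp only: *)
      then have "(d - e) *\<^sub>R \<phi> g w = (d - e) *\<^sub>R w"
        by (simp add: scaleR_left_diff_distrib)
      then have "\<phi> g w = w"
        using \<open>d \<noteq> e\<close> by simp
      then have "\<phi> g u = u"
        using *(1) by simp
      then show False
        using \<open>\<phi> g w = w\<close> that by (auto simp: bad_def)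
    qed
    then show ?thesis
      by (metis finite.emptyI finite.insertI finite_subset insertCI subsetI ex_in_conv)
  qed
  then have "finite (\<Union>g\<in>carrier G. bad g)"
    using fin by blast
  then obtain e where e: "e \<notin> (\<Union>g\<in>carrier G. bad g)"
    using ex_new_if_finite infinite_UNIV_char_0 by blast
  have "stabilizer G \<phi> (u + e *\<^sub>R w) = stabilizer G \<phi> u \<inter> stabilizer G \<phi> w"
    using e lin by (auto simp: stabilizer_def bad_def)
  then show thesis
    using that by blast
qed

section \<open>Irreducible subspaces detecting a vector that is not fixed\<close>

text \<open>
  Maschke's argument: averaging the conjugates of an arbitrary linear projection onto \<open>U\<close> over the
  group gives a projection onto \<open>U\<close> that commutes with the action.
\<close>

lemma equivariant_projection:
  assumes fin: "finite (carrier G)" and U: "invariant_subspace G \<phi> U"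
  obtains q where "linear q" "\<And>g x. g \<in> carrier G \<Longrightarrow> q (\<phi> g x) = \<phi> g (q x)"
    and "\<And>x. q x \<in> U" "\<And>u. u \<in> U \<Longrightarrow> q u = u"
proof -
  interpret group G by (rule group_G)
  have sU: "Real_Vector_Spaces.subspace U"
    and iU: "\<And>g u. g \<in> carrier G \<Longrightarrow> u \<in> U \<Longrightarrow> \<phi> g u \<in> U"
    using U by (auto simp: invariant_subspace_def)
  obtain p where p: "range p \<subseteq> U" "linear p" "\<forall>u\<in>U. p u = u"
    using linear_exists_left_inverse_on[OF linear_id sU] by (auto simp: id_def)
  define s where "s x = (\<Sum>g\<in>carrier G. \<phi> g (p (\<phi> (inv g) x)))" for x
  define q where "q x = inverse (real (card (carrier G))) *\<^sub>R s x" for x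
  have card0: "card (carrier G) \<noteq> 0"
    using fin one_closed by auto
  have "linear (\<lambda>x. \<phi> g (p (\<phi> (inv g) x)))" if "g \<in> carrier G" for g
    using linear_compose[OF linear_compose[OF linear_action p(2)] linear_action, of "inv g" g] that
    by (simp add: o_def)
  then have "linear s"
    unfolding s_def by (intro linear_compose_sum) blast
  then have "linear q"
    unfolding q_def by (rule linear_compose_scale_right)
  have s_eq: "s (\<phi> h x) = \<phi> h (s x)" if h: "h \<in> carrier G" for h x
  proof -
    have "s (\<phi> h x) = (\<Sum>g\<in>carrier G. \<phi> (h \<otimes> g) (p (\<phi> (inv (h \<otimes> g)) (\<phi> h x))))"
      unfolding s_def
    proof (rule sum.reindex_bij_betw[symmetric, where h="\<lambda>g. h \<otimes> g"])
      show "bij_betw ((\<otimes>) h) (carrier G) (carrier G)"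
        using h by (intro bij_betw_byWitness[where f'="\<lambda>g. inv h \<otimes> g"])
          (auto simp: m_assoc[symmetric])
    qed
    also have "\<dots> = (\<Sum>g\<in>carrier G. \<phi> h (\<phi> g (p (\<phi> (inv g) x))))"
      using h by (intro sum.cong refl) (simp add: act_mult inv_mult_group act_inv_left)
    also have "\<dots> = \<phi> h (s x)"
      unfolding s_def using linear_action[OF h] by (simp add: linear_sum)
    finally show ?thesis .
  qed
  show thesis
  proof (rule that[of q])
    show "linear q" by fact
    show "q (\<phi> g x) = \<phi> g (q x)" if "g \<in> carrier G" for g x
      using that by (simp add: q_def s_eq linear_scale[OF linear_action])
    show "q x \<in> U" for x
      unfolding q_def s_def using p(1)
      by (intro subspace_scale[OF sU] subspace_sum[OF sU] iU) auto
    show "q u = u" if "u \<in> U" for u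
    proof -
      have "s u = (\<Sum>g\<in>carrier G. u)"
        unfolding s_def using that p(3) by (intro sum.cong refl) (simp add: iU act_inv_right)
      then show ?thesis
        using card0 by (simp add: q_def sum_constant_scaleR)
    qed
  qed
qed

end

text \<open>
  Strict monotonicity of dimension, phrased with finite spanning sets because the ambient space may
  have infinite dimension.
\<close>

lemma card_basis_proper_subspace:
  fixes U :: "'v::real_vector set"
  assumes "Real_Vector_Spaces.subspace U" "U \<subseteq> span B" "U \<noteq> span B" "finite B"
  obtains C where "finite C" "U = span C" "card C < card B"
proof -
  obtain C where C: "C \<subseteq> U" "independent C" "U \<subseteq> span C"
    using maximal_independent_subset by blast
  have UC: "U = span C"
    using C assms(1) by (metis span_subspace)
  obtain x where x: "x \<in> span B" "x \<notin> U"
    using assms by blast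
  have "independent (insert x C)"
    using C(2) x(2) UC by (simp add: independent_insertI)
  moreover have "insert x C \<subseteq> span B"
    using x(1) C(1) assms(2) by blast
  ultimately have "finite (insert x C) \<and> card (insert x C) \<le> card B"
    by (rule independent_span_bound[OF assms(4)])
  moreover have "x \<notin> C"
    using x(2) C(1) by blast
  ultimately show thesis
    using that[of C] UC by (auto simp: card_insert_if)
qed

context linear_group_action
begin

lemma invariant_span_of_orbit:
  assumes "finite (carrier G)"
  shows "invariant_subspace G \<phi> (span ((\<lambda>g. \<phi> g v) ` carrier G))"
proof -
  interpret group G by (rule group_G)
  let ?O = "(\<lambda>g. \<phi> g v) ` carrier G"
  have "\<phi> g x \<in> span ?O" if g: "g \<in> carrier G" and x: "x \<in> span ?O" for g x
  proof -
    have "\<phi> g ` ?O \<subseteq> ?O"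
      using g by (auto simp: act_mult[symmetric])
    then have "span (\<phi> g ` ?O) \<subseteq> span ?O"
      by (rule span_mono)
    then show ?thesis
      using x linear_span_image[OF linear_action[OF g], of ?O] by blast
  qed
  then show ?thesis
    by (simp add: invariant_subspace_def)
qed

text \<open>
  The irreducible subspace is one of least dimension among the finite-dimensional invariant
  subspaces that contain a vector fixed by \<open>K\<close> but not by the whole group.
\<close>

lemma irreducible_subspace_with_new_fixed_vector:
  assumes fin: "finite (carrier G)"
    and K: "K \<subseteq> stabilizer G \<phi> v" and v: "stabilizer G \<phi> v \<noteq> carrier G"
  obtains E B w where "irreducible_subspace G \<phi> E" "finite B" "E = span B" "w \<in> E"
    and "K \<subseteq> stabilizer G \<phi> w" "stabilizer G \<phi> w \<noteq> carrier G"
proof -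
  interpret group G by (rule group_G)
  define P where "P B \<longleftrightarrow> finite B \<and> invariant_subspace G \<phi> (span B) \<and>
    (\<exists>w\<in>span B. K \<subseteq> stabilizer G \<phi> w \<and> stabilizer G \<phi> w \<noteq> carrier G)" for B
  have "v \<in> span ((\<lambda>g. \<phi> g v) ` carrier G)"
    by (rule span_base) (auto intro!: image_eqI[of _ _ "\<one>"] simp: act_one)
  then have "P ((\<lambda>g. \<phi> g v) ` carrier G)"
    unfolding P_def using fin K v invariant_span_of_orbit[OF fin] by blast
  then obtain B where B: "P B" and least: "\<And>C. P C \<Longrightarrow> card B \<le> card C"
    using arg_min_natI[of P _ card] arg_min_nat_le[of P _ card] by metis
  obtain w where w: "w \<in> span B" "K \<subseteq> stabilizer G \<phi> w" "stabilizer G \<phi> w \<noteq> carrier G"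
    using B by (auto simp: P_def)
  have inv: "invariant_subspace G \<phi> (span B)" and finB: "finite B"
    using B by (auto simp: P_def)
  \<comment> \<open>Minimality: in a smaller invariant subspace, being fixed by \<open>K\<close> forces being fixed by \<open>G\<close>.\<close>
  have fixed: "stabilizer G \<phi> x = carrier G"
    if U: "invariant_subspace G \<phi> U" "U \<subseteq> span B" "U \<noteq> span B" "x \<in> U" "K \<subseteq> stabilizer G \<phi> x" for U x
  proof (rule ccontr)
    assume "stabilizer G \<phi> x \<noteq> carrier G"
    obtain C where "finite C" "U = span C" "card C < card B"
      using card_basis_proper_subspace[OF _ U(2,3) finB] U(1)
      by (auto simp: invariant_subspace_def)
    then have "P C"
      using U \<open>stabilizer G \<phi> x \<noteq> carrier G\<close> by (auto simp: P_def)
    then show False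
      using least \<open>card C < card B\<close> by fastforce
  qed
  have "U = {0} \<or> U = span B" if U: "invariant_subspace G \<phi> U" "U \<subseteq> span B" for U
  proof (rule ccontr)
    assume neg: "\<not> (U = {0} \<or> U = span B)"
    have sU: "Real_Vector_Spaces.subspace U"
      using U(1) by (simp add: invariant_subspace_def)
    obtain q where q: "linear q" "\<And>g x. g \<in> carrier G \<Longrightarrow> q (\<phi> g x) = \<phi> g (q x)"
      "\<And>x. q x \<in> U" "\<And>u. u \<in> U \<Longrightarrow> q u = u"
      using equivariant_projection[OF fin U(1)] by blast
    \<comment> \<open>The kernel of \<open>q\<close> is an invariant complement of \<open>U\<close>, so \<open>w = q w + (w - q w)\<close> splits along
      two smaller invariant subspaces.\<close>
    let ?U' = "span B \<inter> {x. q x = 0}"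
    have U': "invariant_subspace G \<phi> ?U'"
      using inv q(1,2) linear_subspace_kernel[OF q(1)] linear_0[OF linear_action]
      by (auto simp: invariant_subspace_def subspace_inter)
    have "?U' \<noteq> span B"
    proof -
      obtain u where "u \<in> U" "u \<noteq> 0"
        using neg subspace_0[OF sU] by blast
      then show ?thesis
        using q(4) U(2) by force
    qed
    have K_fix: "\<phi> g w = w" if "g \<in> K" for g
      using w(2) that by (auto simp: stabilizer_def)
    have KG: "K \<subseteq> carrier G"
      using w(2) stabilizer_subset by blast
    have Kq: "K \<subseteq> stabilizer G \<phi> (q w)"
      using K_fix KG q(2)[symmetric] unfolding stabilizer_def by auto
    have Kq': "K \<subseteq> stabilizer G \<phi> (w - q w)"
    proof
      fix g assume g: "g \<in> K"
      then have "g \<in> carrier G" "\<phi> g (q w) = q w"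
        using KG Kq by (auto simp: stabilizer_def)
      then show "g \<in> stabilizer G \<phi> (w - q w)"
        by (simp add: stabilizer_def linear_diff[OF linear_action] K_fix[OF g])
    qed
    have "w - q w \<in> ?U'"
      using w(1) q(3)[of w] U(2) by (auto simp: linear_diff[OF q(1)] q(4) intro: span_diff)
    then have "stabilizer G \<phi> (w - q w) = carrier G"
      using fixed[OF U' _ \<open>?U' \<noteq> span B\<close> _ Kq'] by blast
    moreover have "stabilizer G \<phi> (q w) = carrier G"
      using fixed[OF U _ q(3) Kq] neg by blast
    ultimately have "\<phi> g (q w) = q w \<and> \<phi> g (w - q w) = w - q w" if "g \<in> carrier G" for g
      using that unfolding stabilizer_def by blast
    then have "\<phi> g w = w" if "g \<in> carrier G" for g
      using that linear_add[OF linear_action[OF that], of "q w" "w - q w"] by simp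
    then show False
      using w(3) by (auto simp: stabilizer_def)
  qed
  moreover have "span B \<noteq> {0}"
  proof
    assume "span B = {0}"
    then have "w = 0"
      using w(1) by simp
    then show False
      using w(3) linear_0[OF linear_action] by (auto simp: stabilizer_def)
  qed
  ultimately have "irreducible_subspace G \<phi> (span B)"
    using inv by (auto simp: irreducible_subspace_def)
  then show thesis
    using that finB w by blast
qed

section \<open>The matrix representation on an irreducible subspace\<close>

text \<open>
  In coordinates with respect to a basis \<open>b\<close> of \<open>E\<close>, the map \<open>L\<close> from column vectors to \<open>E\<close> is a
  linear bijection with inverse \<open>coord\<close>, and it intertwines the matrix \<open>\<alpha> g\<close> with \<open>\<phi> g\<close>. Both
  the homomorphism property and irreducibility of \<open>\<alpha>\<close> are transported along \<open>L\<close>.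
\<close>

lemma irreducible_subspace_has_representation:
  assumes E: "irreducible_subspace G \<phi> E" and B: "finite B" "E = span B"
  obtains n \<alpha> where "irreducible_representation G n \<alpha>" "corresponds_to G \<phi> E n \<alpha>"
proof -
  interpret group G by (rule group_G)
  have invE: "\<And>g v. g \<in> carrier G \<Longrightarrow> v \<in> E \<Longrightarrow> \<phi> g v \<in> E" and E0: "E \<noteq> {0}"
    and irr: "\<And>U. invariant_subspace G \<phi> U \<Longrightarrow> U \<subseteq> E \<Longrightarrow> U = {0} \<or> U = E"
    using E by (auto simp: irreducible_subspace_def invariant_subspace_def)
  obtain C where C: "C \<subseteq> B" "independent C" "B \<subseteq> span C"
    using maximal_independent_subset by blast
  have EC: "span C = E"
    using C(1,3) B(2) by (metis span_eq span_mono span_superset subset_trans)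
  have "finite C"
    using C(1) B(1) finite_subset by blast
  then obtain b where b: "set b = C" "distinct b"
    using finite_distinct_list by blast
  define n where "n = length b"
  define L where "L x = (\<Sum>i<n. (x $ i) *\<^sub>R (b ! i))" for x :: "real vec"
  define coord where "coord v = vec n (\<lambda>i. representation C v (b ! i))" for v
  define \<alpha> where "\<alpha> g = mat n n (\<lambda>(i, j). coord (\<phi> g (b ! j)) $ i)" for g
  have bE: "b ! i \<in> E" if "i < n" for i
    using that b(1) EC span_superset n_def nth_mem by blast
  have bC: "b ! i \<in> C" if "i < n" for i
    using that b(1) n_def nth_mem by blast
  have bij: "bij_betw ((!) b) {..<n} C"
    using b by (simp add: n_def bij_betw_nth)
  have L_coord: "L (coord v) = v" if "v \<in> E" for v
  proof -
    have "L (coord v) = (\<Sum>i<n. representation C v (b ! i) *\<^sub>R (b ! i))"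
      by (simp add: L_def coord_def)
    also have "\<dots> = (\<Sum>c\<in>C. representation C v c *\<^sub>R c)"
      using sum.reindex_bij_betw[OF bij, of "\<lambda>c. representation C v c *\<^sub>R c"] by simp
    also have "\<dots> = v"
      using that EC C(2) \<open>finite C\<close> by (intro sum_representation_eq) auto
    finally show ?thesis .
  qed
  have coord_L: "coord (L x) = x" if "x \<in> carrier_vec n" for x
  proof -
    have "representation C (L x) (b ! i) = x $ i" if "i < n" for i
    proof -
      have "representation C (L x) (b ! i) = (\<Sum>j<n. representation C ((x $ j) *\<^sub>R (b ! j)) (b ! i))"
        unfolding L_def using C(2) EC bE
        by (subst representation_sum) (auto intro: span_scale)
      also have "\<dots> = (\<Sum>j<n. if j = i then x $ j else 0)"
        using C(2) EC bE bC that b(2)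
        by (intro sum.cong refl)
          (auto simp: representation_scale representation_basis n_def nth_eq_iff_index_eq)
      finally show ?thesis
        using that by simp
    qed
    then show ?thesis
      using that by (auto simp: coord_def)
  qed
  have L_inj: "x = y" if "x \<in> carrier_vec n" "y \<in> carrier_vec n" "L x = L y" for x y
    using that coord_L by metis
  have L_E: "L x \<in> E" for x
    unfolding L_def using bE EC by (metis (no_types, lifting) lessThan_iff span_scale span_sum)
  have \<alpha>_carrier: "\<alpha> g \<in> carrier_mat n n" for g
    by (simp add: \<alpha>_def)
  have L_col: "L (col (\<alpha> g) j) = \<phi> g (b ! j)" if "g \<in> carrier G" "j < n" for g j
  proof -
    have "col (\<alpha> g) j = coord (\<phi> g (b ! j))"
      using that by (auto simp: \<alpha>_def coord_def)
    then show ?thesis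
      using that by (simp add: L_coord invE bE)
  qed
  have \<phi>_b: "\<phi> g (b ! j) = (\<Sum>i<n. (\<alpha> g $$ (i, j)) *\<^sub>R (b ! i))" if "g \<in> carrier G" "j < n" for g j
    using L_col[OF that] that \<alpha>_carrier[of g] by (auto simp: L_def)
  have L_mult: "L (\<alpha> g *\<^sub>v x) = \<phi> g (L x)" if g: "g \<in> carrier G" and x: "x \<in> carrier_vec n" for g x
  proof -
    have "L (\<alpha> g *\<^sub>v x) = (\<Sum>i<n. (\<Sum>j<n. \<alpha> g $$ (i, j) * x $ j) *\<^sub>R (b ! i))"
      using x \<alpha>_carrier[of g]
      by (auto simp: L_def scalar_prod_def lessThan_atLeast0 intro!: sum.cong)
    also have "\<dots> = (\<Sum>i<n. \<Sum>j<n. (x $ j) *\<^sub>R ((\<alpha> g $$ (i, j)) *\<^sub>R (b ! i)))"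
      by (simp add: scaleR_sum_left mult.commute)
    also have "\<dots> = (\<Sum>j<n. \<Sum>i<n. (x $ j) *\<^sub>R ((\<alpha> g $$ (i, j)) *\<^sub>R (b ! i)))"
      by (rule sum.swap)
    also have "\<dots> = (\<Sum>j<n. (x $ j) *\<^sub>R \<phi> g (b ! j))"
      using g by (intro sum.cong refl) (simp add: \<phi>_b scaleR_sum_right)
    also have "\<dots> = \<phi> g (L x)"
      using linear_action[OF g] by (simp add: L_def linear_sum linear_scale)
    finally show ?thesis .
  qed
  \<comment> \<open>Matrices are compared column by column, after applying the injective map \<open>L\<close>.\<close>
  have \<alpha>_mult: "\<alpha> (g \<otimes> h) = \<alpha> g * \<alpha> h" if "g \<in> carrier G" "h \<in> carrier G" for g h
  proof (rule mat_col_eqI)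
    fix j assume "j < dim_col (\<alpha> g * \<alpha> h)"
    then have j: "j < n"
      using \<alpha>_carrier[of h] by auto
    have col: "col (\<alpha> g * \<alpha> h) j = \<alpha> g *\<^sub>v col (\<alpha> h) j"
      using j \<alpha>_carrier by (metis col_mult2)
    have cc: "col (\<alpha> h) j \<in> carrier_vec n" "col (\<alpha> (g \<otimes> h)) j \<in> carrier_vec n"
      using \<alpha>_carrier col_carrier_vec[OF j] by metis+
    have mc: "\<alpha> g *\<^sub>v col (\<alpha> h) j \<in> carrier_vec n"
      using \<alpha>_carrier cc(1) by (metis mult_mat_vec_carrier)
    show "col (\<alpha> (g \<otimes> h)) j = col (\<alpha> g * \<alpha> h) j"
      unfolding col
      by (rule L_inj[OF cc(2) mc]) (use that j cc in \<open>simp add: L_col L_mult act_mult\<close>)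
  qed (simp_all add: carrier_matD[OF \<alpha>_carrier])
  have \<alpha>_one: "\<alpha> \<one> = 1\<^sub>m n"
  proof (rule mat_col_eqI)
    fix j assume "j < dim_col (1\<^sub>m n :: real mat)"
    then have j: "j < n" by simp
    have "L (unit_vec n j) = (\<Sum>i<n. if i = j then b ! i else 0)"
      unfolding L_def using j by (intro sum.cong refl) auto
    then have "L (unit_vec n j) = b ! j"
      using j by simp
    then have "col (\<alpha> \<one>) j = unit_vec n j"
      using j \<alpha>_carrier by (intro L_inj) (auto simp: L_col act_one)
    then show "col (\<alpha> \<one>) j = col (1\<^sub>m n) j"
      using j by simp
  qed (use \<alpha>_carrier in auto)
  have "\<alpha> g \<in> Units (ring_mat TYPE(real) n ())" if "g \<in> carrier G" for g
    using that \<alpha>_carrier \<alpha>_mult[of g "inv g"] \<alpha>_mult[of "inv g" g]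
    by (auto simp: Units_def ring_mat_simps \<alpha>_one intro!: bexI[of _ "\<alpha> (inv g)"])
  then have hom: "\<alpha> \<in> hom G (units_of (ring_mat TYPE(real) n ()))"
    by (auto simp: hom_def units_of_def ring_mat_simps \<alpha>_mult)
  have "n > 0"
  proof (rule ccontr)
    assume "\<not> n > 0"
    then have "C = {}"
      using b(1) by (simp add: n_def)
    then show False
      using EC E0 by simp
  qed
  have "W = {0\<^sub>v n} \<or> W = carrier_vec n"
    if W: "VectorSpace.subspace class_ring W (module_vec TYPE(real) n)"
      and inv: "\<forall>g \<in> carrier G. \<forall>w \<in> W. \<alpha> g *\<^sub>v w \<in> W" for W
  proof -
    have sub: "submodule class_ring W (module_vec TYPE(real) n)"
      using W by (simp add: VectorSpace.subspace_def)
    have Wc: "W \<subseteq> carrier_vec n" and W0: "0\<^sub>v n \<in> W"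
      and Wadd: "\<And>x y. x \<in> W \<Longrightarrow> y \<in> W \<Longrightarrow> x + y \<in> W"
      and Wsm: "\<And>c x. x \<in> W \<Longrightarrow> c \<cdot>\<^sub>v x \<in> W"
      using submodule.subset[OF sub] submodule.zero_closed[OF sub] submodule.m_closed[OF sub]
        submodule.smult_closed[OF sub]
      by (simp_all add: module_vec_simps class_ring_simps)
    have L0: "L (0\<^sub>v n) = 0"
      by (simp add: L_def)
    have Ladd: "L (x + y) = L x + L y" if "x \<in> W" "y \<in> W" for x y
      using that Wc by (auto simp: L_def scaleR_left_distrib sum.distrib[symmetric] intro!: sum.cong)
    have Lsm: "L (c \<cdot>\<^sub>v x) = c *\<^sub>R L x" if "x \<in> W" for c x
      using that Wc by (auto simp: L_def scaleR_sum_right intro!: sum.cong)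
    have "Real_Vector_Spaces.subspace (L ` W)"
    proof (rule real_vector.subspaceI)
      show "0 \<in> L ` W"
        using L0 W0 by (metis imageI)
    qed (use Wadd Wsm in \<open>auto simp: Ladd[symmetric] Lsm[symmetric]\<close>)
    moreover have "\<phi> g x \<in> L ` W" if "g \<in> carrier G" "x \<in> L ` W" for g x
      using that inv Wc by (auto simp: L_mult[symmetric] subset_iff)
    ultimately have "invariant_subspace G \<phi> (L ` W)"
      by (simp add: invariant_subspace_def)
    then consider "L ` W = {0}" | "L ` W = E"
      using irr[of "L ` W"] L_E by blast
    then show ?thesis
    proof cases
      case 1
      then have "x = 0\<^sub>v n" if "x \<in> W" for x
        using that Wc L0 by (intro L_inj) auto
      then show ?thesis
        using W0 by blast
    next
      case 2
      have "x \<in> W" if x: "x \<in> carrier_vec n" for x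
      proof -
        obtain y where "y \<in> W" "L y = L x"
          using 2 L_E by (metis imageE)
        then show ?thesis
          using L_inj x Wc by blast
      qed
      then show ?thesis
        using Wc by blast
    qed
  qed
  then have "irreducible_representation G n \<alpha>"
    using hom \<open>n > 0\<close> by (simp add: irreducible_representation_def)
  moreover have "corresponds_to G \<phi> E n \<alpha>"
    unfolding corresponds_to_def using b C(2) EC \<phi>_b
    by (intro exI[of _ b]) (simp add: n_def)
  ultimately show thesis
    using that by blast
qed

text \<open>
  Vectors fixed by \<open>K\<close> but not by the group can be found already inside a single isotypic
  component. Applied below to the group \<open>\<Gamma>\<close> with \<open>K = \<Sigma>\<close>.
\<close>

lemma isotypic_component_with_new_fixed_vector:
  assumes fin: "finite (carrier G)"
    and K: "K \<subseteq> stabilizer G \<phi> v" and v: "stabilizer G \<phi> v \<noteq> carrier G"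
  obtains W w where "W \<in> isotypic_components G \<phi>" "w \<in> W"
    and "K \<subseteq> stabilizer G \<phi> w" "stabilizer G \<phi> w \<noteq> carrier G"
proof -
  obtain E B w where E: "irreducible_subspace G \<phi> E" "finite B" "E = span B"
    and w: "w \<in> E" "K \<subseteq> stabilizer G \<phi> w" "stabilizer G \<phi> w \<noteq> carrier G"
    using irreducible_subspace_with_new_fixed_vector[OF assms] by metis
  obtain n \<alpha> where \<alpha>: "irreducible_representation G n \<alpha>" "corresponds_to G \<phi> E n \<alpha>"
    using irreducible_subspace_has_representation[OF E] by metis
  have "w \<in> isotypic_component G \<phi> n \<alpha>"
    unfolding isotypic_component_def using E(1) \<alpha>(2) w(1) by (intro span_base) blast
  moreover have "isotypic_component G \<phi> n \<alpha> \<in> isotypic_components G \<phi>"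
    unfolding isotypic_components_def using \<alpha>(1) by blast
  ultimately show thesis
    using that w(2,3) by blast
qed

end

section \<open>Arrows of the isotropy lattice\<close>

lemma stabilizer_restrict_carrier:
  "H \<subseteq> carrier G \<Longrightarrow> stabilizer (G\<lparr>carrier := H\<rparr>) \<phi> x = H \<inter> stabilizer G \<phi> x"
  by (auto simp: stabilizer_def)

context linear_group_action
begin

text \<open>
  A covering relation between conjugacy classes is inherited by nested representatives, because
  nested conjugate isotropy subgroups are equal.
\<close>

lemma no_isotropy_subgroup_inside_lattice_arrow:
  assumes fin: "finite (carrier G)"
    and arrow: "isotropy_lattice_arrow G \<phi> (conjugacy_class G \<Gamma>) (conjugacy_class G \<Sigma>)"
    and iso: "\<Gamma> \<in> isotropy_subgroups G \<phi> UNIV" "\<Sigma> \<in> isotropy_subgroups G \<phi> UNIV"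
      "\<Theta> \<in> isotropy_subgroups G \<phi> UNIV"
    and sub: "\<Sigma> \<subseteq> \<Theta>" "\<Theta> \<subseteq> \<Gamma>"
  shows "\<Theta> = \<Sigma> \<or> \<Theta> = \<Gamma>"
proof -
  obtain u v x where eqs: "\<Gamma> = stabilizer G \<phi> u" "\<Sigma> = stabilizer G \<phi> v" "\<Theta> = stabilizer G \<phi> x"
    using iso by (auto simp: isotropy_subgroups_def)
  have le: "symmetry_type_le (conjugacy_class G \<Sigma>) (conjugacy_class G \<Theta>)"
    "symmetry_type_le (conjugacy_class G \<Theta>) (conjugacy_class G \<Gamma>)"
    using sub stabilizer_in_own_class unfolding eqs symmetry_type_le_def by blast+
  have "conjugacy_class G \<Theta> \<in> symmetry_types G \<phi>"
    using iso(3) by (auto simp: symmetry_types_def)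
  then have "conjugacy_class G \<Sigma> = conjugacy_class G \<Theta> \<or> conjugacy_class G \<Theta> = conjugacy_class G \<Gamma>"
    using arrow le unfolding isotropy_lattice_arrow_def symmetry_type_less_def by blast
  then show ?thesis
    using nested_conjugate_stabilizers_eq[OF fin] sub unfolding eqs by blast
qed

lemma lattice_arrow_representatives:
  assumes "isotropy_lattice_arrow G \<phi> S S'"
  obtains \<Gamma> \<Sigma> where "\<Gamma> \<in> isotropy_subgroups G \<phi> UNIV" "\<Sigma> \<in> isotropy_subgroups G \<phi> UNIV"
    and "S = conjugacy_class G \<Gamma>" "S' = conjugacy_class G \<Sigma>" "\<Sigma> \<subseteq> \<Gamma>" "\<Sigma> \<noteq> \<Gamma>"
proof -
  obtain \<Gamma> \<Sigma> where mem: "\<Sigma> \<in> S'" "\<Gamma> \<in> S" "\<Sigma> \<subseteq> \<Gamma>" and "S' \<noteq> S"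
    using assms by (auto simp: isotropy_lattice_arrow_def symmetry_type_less_def symmetry_type_le_def)
  have types: "S \<in> symmetry_types G \<phi>" "S' \<in> symmetry_types G \<phi>"
    using assms by (auto simp: isotropy_lattice_arrow_def)
  show thesis
    using that representative_of_symmetry_type[OF types(1) mem(2)]
      representative_of_symmetry_type[OF types(2) mem(1)] mem(3) \<open>S' \<noteq> S\<close>
    by metis
qed

end

theorem theorem4p15:
  fixes G :: "('g, 'm) monoid_scheme"
    and \<phi> :: "'g \<Rightarrow> 'v::real_vector \<Rightarrow> 'v"
    and S S' :: "'g set set"
  assumes "linear_group_action G \<phi>"
    and "finite (carrier G)"
    and "S \<in> symmetry_types G \<phi>" and "S' \<in> symmetry_types G \<phi>"
    and "isotropy_lattice_arrow G \<phi> S S'"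
  shows "bifurcation_arrow G \<phi> S S'"
proof -
  interpret linear_group_action G \<phi> by fact
  note fin = assms(2) and arrow = assms(5)
  obtain \<Gamma> \<Sigma> where iso: "\<Gamma> \<in> isotropy_subgroups G \<phi> UNIV" "\<Sigma> \<in> isotropy_subgroups G \<phi> UNIV"
    and cls: "S = conjugacy_class G \<Gamma>" "S' = conjugacy_class G \<Sigma>"
    and sub: "\<Sigma> \<subseteq> \<Gamma>" "\<Sigma> \<noteq> \<Gamma>"
    using lattice_arrow_representatives[OF arrow] by metis
  obtain u v where uv: "\<Gamma> = stabilizer G \<phi> u" "\<Sigma> = stabilizer G \<phi> v"
    using iso by (auto simp: isotropy_subgroups_def)
  have \<Gamma>G: "\<Gamma> \<subseteq> carrier G"
    unfolding uv by (rule stabilizer_subset)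
  let ?H = "G\<lparr>carrier := \<Gamma>\<rparr>"
  interpret H: linear_group_action ?H \<phi>
    by (rule restrict_to_subgroup) (simp add: uv stabilizer_subgroup)
  have finH: "finite (carrier ?H)"
    using fin \<Gamma>G finite_subset by auto
  have stab_H: "stabilizer ?H \<phi> x = \<Gamma> \<inter> stabilizer G \<phi> x" for x
    by (rule stabilizer_restrict_carrier[OF \<Gamma>G])
  \<comment> \<open>Stabilizers in \<open>\<Gamma>\<close> are isotropy subgroups of \<open>G\<close>, so the lattice arrow leaves no room
    between \<open>\<Sigma>\<close> and \<open>\<Gamma>\<close>.\<close>
  have dichotomy: "stabilizer ?H \<phi> x = \<Sigma> \<or> stabilizer ?H \<phi> x = \<Gamma>"
    if "\<Sigma> \<subseteq> stabilizer ?H \<phi> x" for x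
  proof -
    obtain y where "stabilizer G \<phi> y = \<Gamma> \<inter> stabilizer G \<phi> x"
      unfolding uv using Int_of_stabilizers_is_stabilizer[OF fin] by metis
    then have "stabilizer ?H \<phi> x \<in> isotropy_subgroups G \<phi> UNIV"
      unfolding stab_H isotropy_subgroups_def by blast
    then show ?thesis
      using no_isotropy_subgroup_inside_lattice_arrow[OF fin arrow[unfolded cls] iso _ that] stab_H
      by blast
  qed
  have "stabilizer ?H \<phi> v = \<Sigma>"
    using sub(1) uv(2) stab_H by blast
  then obtain W w where W: "W \<in> isotypic_components ?H \<phi>" "w \<in> W"
    and w: "\<Sigma> \<subseteq> stabilizer ?H \<phi> w" "stabilizer ?H \<phi> w \<noteq> \<Gamma>"
    using H.isotypic_component_with_new_fixed_vector[OF finH, of \<Sigma> v] sub(2) by auto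
  then have "stabilizer ?H \<phi> w = \<Sigma>"
    using dichotomy by blast
  then have "\<Sigma> \<in> isotropy_subgroups ?H \<phi> W"
    using W(2) by (auto simp: isotropy_subgroups_def)
  then have "maximal_isotropy_subgroup ?H \<phi> W \<Sigma>"
    using sub(2) dichotomy by (auto simp: maximal_isotropy_subgroup_def isotropy_subgroups_def)
  then show ?thesis
    unfolding bifurcation_arrow_def using iso sub(1) cls W(1) by blast
qed

end
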